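(* Let $\Lambda$ be a finitely aligned left cancellative small category. Then the mutually inverse bijections $$\Phi:\widehat{\mathcal{E}}_*\to\Lambda^*,\ \eta\mapsto\Delta_\eta,\qquad \Psi:\Lambda^*\to\widehat{\mathcal{E}}_*,\ F\mapsto\eta_F$$ are homeomorphisms.
   Context: A small category $\Lambda$ is identified with its set of morphisms, objects with identity morphisms; $s(\alpha)$ is the domain and $r(\alpha)$ the range of $\alpha$; $\alpha\beta$ is defined when $s(\alpha)=r(\beta)$; $\alpha\Lambda=\{\alpha\beta: r(\beta)=s(\alpha)\}$. $\Lambda$ is left cancellative if $\alpha\beta=\alpha\gamma$ implies $\beta=\gamma$; finitely aligned if for all $\alpha,\beta$ there is a finite $\Gamma\subset\Lambda$ with $\alpha\Lambda\cap\beta\Lambda=\bigcup_{\gamma\in\Gamma}\gamma\Lambda$. $\alpha\le\beta$ means $\beta\in\alpha\Lambda$. $\tau^\alpha:s(\alpha)\Lambda\to\alpha\Lambda$, $\beta\mapsto\alpha\beta$, $\sigma^\alpha:=(\tau^\alpha)^{-1}$; $\mathcal{S}_\Lambda$ is the inverse semigroup of partial bijections of $\Lambda$ generated by all of these; $\mathcal{E}$ is its semilattice of idempotents ($e\le f$ iff $e=ef$). Each $e\in\mathcal{E}$ is a finite join $\bigvee_{i=1}^n\tau^{\alpha_i}\sigma^{\alpha_i}$ (the identity map of $\bigcup_i\alpha_i\Lambda$). A filter is a nonempty $\eta\subseteq\mathcal{E}$ not containing the empty map $0$, upward closed and closed under products. The set $\hat{\mathcal{E}}_0$ of filters has the topology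 with basis $\{\eta: X\subseteq\eta,\ Y\cap\eta=\emptyset\}$, $X,Y\subset\mathcal{E}$ finite. $\eta$ satisfies condition $( * )$ if whenever $\bigvee_{i=1}^n\tau^{\alpha_i}\sigma^{\alpha_i}\in\eta$, there is $1\le j\le n$ with $\tau^{\alpha_j}\sigma^{\alpha_j}\in\eta$. $\widehat{\mathcal{E}}_*$ is the set of filters satisfying $( * )$, with the subspace topology. $\Lambda^*$ is the set of nonempty $F\subseteq\Lambda$ that are hereditary ($\alpha\le\beta\in F\Rightarrow\alpha\in F$) and directed (for $\alpha,\beta\in F$ there is $\gamma\in F$ with $\alpha,\beta\le\gamma$), with the topology with basis $\{F\in\Lambda^*: X\subseteq F,\ Y\cap F=\emptyset\}$, $X,Y\subset\Lambda$ finite. $\Delta_\eta=\{\alpha\in\Lambda:\tau^\alpha\sigma^\alpha\in\eta\}$ and $\eta_F=\{f\in\mathcal{E}: f\ge\tau^\alpha\sigma^\alpha\text{ for some }\alpha\in F\}$. *)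

theory Defs
  imports "HOL-Analysis.Abstract_Topology"
begin

section \<open>Small categories as sets of morphisms\<close>

text \<open>Objects are identified with their identity morphisms, so \<open>src\<close> and \<open>rng\<close> take values in
  the morphisms. The product \<open>\<alpha> \<cdot> \<beta>\<close> is meaningful only when \<open>src \<alpha> = rng \<beta>\<close>; elsewhere it is
  an unconstrained value.\<close>

record 'a small_cat =
  mor :: "'a set"
  src :: "'a \<Rightarrow> 'a"
  rng :: "'a \<Rightarrow> 'a"
  cmp :: "'a \<Rightarrow> 'a \<Rightarrow> 'a"  (infixl "\<cdot>\<index>" 70)

locale small_category =
  fixes \<Lambda> :: "('a, 'm) small_cat_scheme"  (structure)
  assumes src_mor: "\<alpha> \<in> mor \<Lambda> \<Longrightarrow> src \<Lambda> \<alpha> \<in> mor \<Lambda>"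
    and rng_mor: "\<alpha> \<in> mor \<Lambda> \<Longrightarrow> rng \<Lambda> \<alpha> \<in> mor \<Lambda>"
    and src_src: "\<alpha> \<in> mor \<Lambda> \<Longrightarrow> src \<Lambda> (src \<Lambda> \<alpha>) = src \<Lambda> \<alpha>"
    and rng_src: "\<alpha> \<in> mor \<Lambda> \<Longrightarrow> rng \<Lambda> (src \<Lambda> \<alpha>) = src \<Lambda> \<alpha>"
    and src_rng: "\<alpha> \<in> mor \<Lambda> \<Longrightarrow> src \<Lambda> (rng \<Lambda> \<alpha>) = rng \<Lambda> \<alpha>"
    and rng_rng: "\<alpha> \<in> mor \<Lambda> \<Longrightarrow> rng \<Lambda> (rng \<Lambda> \<alpha>) = rng \<Lambda> \<alpha>"
    and cmp_mor: "\<lbrakk>\<alpha> \<in> mor \<Lambda>; \<beta> \<in> mor \<Lambda>; src \<Lambda> \<alpha> = rng \<Lambda> \<beta>\<rbrakk> \<Longrightarrow> \<alpha> \<cdot> \<beta> \<in> mor \<Lambda>"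
    and src_cmp: "\<lbrakk>\<alpha> \<in> mor \<Lambda>; \<beta> \<in> mor \<Lambda>; src \<Lambda> \<alpha> = rng \<Lambda> \<beta>\<rbrakk> \<Longrightarrow> src \<Lambda> (\<alpha> \<cdot> \<beta>) = src \<Lambda> \<beta>"
    and rng_cmp: "\<lbrakk>\<alpha> \<in> mor \<Lambda>; \<beta> \<in> mor \<Lambda>; src \<Lambda> \<alpha> = rng \<Lambda> \<beta>\<rbrakk> \<Longrightarrow> rng \<Lambda> (\<alpha> \<cdot> \<beta>) = rng \<Lambda> \<alpha>"
    and cmp_assoc: "\<lbrakk>\<alpha> \<in> mor \<Lambda>; \<beta> \<in> mor \<Lambda>; \<gamma> \<in> mor \<Lambda>; src \<Lambda> \<alpha> = rng \<Lambda> \<beta>; src \<Lambda> \<beta> = rng \<Lambda> \<gamma>\<rbrakk>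
          \<Longrightarrow> (\<alpha> \<cdot> \<beta>) \<cdot> \<gamma> = \<alpha> \<cdot> (\<beta> \<cdot> \<gamma>)"
    and cmp_src: "\<alpha> \<in> mor \<Lambda> \<Longrightarrow> \<alpha> \<cdot> src \<Lambda> \<alpha> = \<alpha>"
    and rng_cmp_id: "\<alpha> \<in> mor \<Lambda> \<Longrightarrow> rng \<Lambda> \<alpha> \<cdot> \<alpha> = \<alpha>"

definition left_cancellative :: "('a, 'm) small_cat_scheme \<Rightarrow> bool" where
  "left_cancellative \<Lambda> \<longleftrightarrow>
     (\<forall>\<alpha>\<in>mor \<Lambda>. \<forall>\<beta>\<in>mor \<Lambda>. \<forall>\<gamma>\<in>mor \<Lambda>.
        src \<Lambda> \<alpha> = rng \<Lambda> \<beta> \<longrightarrow> src \<Lambda> \<alpha> = rng \<Lambda> \<gamma> \<longrightarrow> \<alpha> \<cdot>\<^bsub>\<Lambda>\<^esub> \<beta> = \<alpha> \<cdot>\<^bsub>\<Lambda>\<^esub> \<gamma> \<longrightarrow> \<beta> = \<gamma>)"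

text \<open>The set written \<open>\<alpha>\<Lambda>\<close>.\<close>

definition rideal :: "('a, 'm) small_cat_scheme \<Rightarrow> 'a \<Rightarrow> 'a set" where
  "rideal \<Lambda> \<alpha> = {\<alpha> \<cdot>\<^bsub>\<Lambda>\<^esub> \<beta> | \<beta>. \<beta> \<in> mor \<Lambda> \<and> rng \<Lambda> \<beta> = src \<Lambda> \<alpha>}"

definition finitely_aligned :: "('a, 'm) small_cat_scheme \<Rightarrow> bool" where
  "finitely_aligned \<Lambda> \<longleftrightarrow>
     (\<forall>\<alpha>\<in>mor \<Lambda>. \<forall>\<beta>\<in>mor \<Lambda>. \<exists>\<Gamma>. finite \<Gamma> \<and> \<Gamma> \<subseteq> mor \<Lambda> \<and>
        rideal \<Lambda> \<alpha> \<inter> rideal \<Lambda> \<beta> = (\<Union>\<gamma>\<in>\<Gamma>. rideal \<Lambda> \<gamma>))"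

definition cat_le :: "('a, 'm) small_cat_scheme \<Rightarrow> 'a \<Rightarrow> 'a \<Rightarrow> bool" where
  "cat_le \<Lambda> \<alpha> \<beta> \<longleftrightarrow> \<beta> \<in> rideal \<Lambda> \<alpha>"

section \<open>The inverse semigroup and its idempotents\<close>

text \<open>Partial bijections of \<open>\<Lambda>\<close> are injective maps of type \<open>'a \<rightharpoonup> 'a\<close> with domain and range in
  \<open>mor \<Lambda>\<close>; their product is \<open>\<circ>\<^sub>m\<close> (the right factor is applied first), the empty map is
  \<open>Map.empty\<close>, and the identity map of \<open>A\<close> is \<open>Some |` A\<close>.\<close>

definition pinverse :: "('a \<rightharpoonup> 'b) \<Rightarrow> ('b \<rightharpoonup> 'a)" where
  "pinverse f = (\<lambda>y. if \<exists>x. f x = Some y then Some (THE x. f x = Some y) else None)"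

definition tau :: "('a, 'm) small_cat_scheme \<Rightarrow> 'a \<Rightarrow> ('a \<rightharpoonup> 'a)" where
  "tau \<Lambda> \<alpha> = (\<lambda>\<beta>. if \<beta> \<in> rideal \<Lambda> (src \<Lambda> \<alpha>) then Some (\<alpha> \<cdot>\<^bsub>\<Lambda>\<^esub> \<beta>) else None)"

definition sigma :: "('a, 'm) small_cat_scheme \<Rightarrow> 'a \<Rightarrow> ('a \<rightharpoonup> 'a)" where
  "sigma \<Lambda> \<alpha> = pinverse (tau \<Lambda> \<alpha>)"

inductive_set inv_semigroup :: "('a, 'm) small_cat_scheme \<Rightarrow> ('a \<rightharpoonup> 'a) set"
  for \<Lambda> :: "('a, 'm) small_cat_scheme"
  where
    tau: "\<alpha> \<in> mor \<Lambda> \<Longrightarrow> tau \<Lambda> \<alpha> \<in> inv_semigroup \<Lambda>"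
  | sigma: "\<alpha> \<in> mor \<Lambda> \<Longrightarrow> sigma \<Lambda> \<alpha> \<in> inv_semigroup \<Lambda>"
  | inverse: "f \<in> inv_semigroup \<Lambda> \<Longrightarrow> pinverse f \<in> inv_semigroup \<Lambda>"
  | product: "\<lbrakk>f \<in> inv_semigroup \<Lambda>; g \<in> inv_semigroup \<Lambda>\<rbrakk> \<Longrightarrow> f \<circ>\<^sub>m g \<in> inv_semigroup \<Lambda>"

definition idems :: "('a, 'm) small_cat_scheme \<Rightarrow> ('a \<rightharpoonup> 'a) set" where
  "idems \<Lambda> = {e \<in> inv_semigroup \<Lambda>. e \<circ>\<^sub>m e = e}"

definition idem_le :: "('a \<rightharpoonup> 'a) \<Rightarrow> ('a \<rightharpoonup> 'a) \<Rightarrow> bool" where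
  "idem_le e f \<longleftrightarrow> e = e \<circ>\<^sub>m f"

definition range_proj :: "('a, 'm) small_cat_scheme \<Rightarrow> 'a \<Rightarrow> ('a \<rightharpoonup> 'a)" where
  "range_proj \<Lambda> \<alpha> = tau \<Lambda> \<alpha> \<circ>\<^sub>m sigma \<Lambda> \<alpha>"

text \<open>The finite join \<open>\<Or>\<^sub>i\<^sub>=\<^sub>1\<^sup>n \<tau>\<^sup>\<alpha>\<^sup>i \<sigma>\<^sup>\<alpha>\<^sup>i\<close>, that is, the identity map of \<open>\<Union>\<^sub>i \<alpha>\<^sub>i\<Lambda>\<close>.\<close>

definition range_proj_join :: "('a, 'm) small_cat_scheme \<Rightarrow> nat \<Rightarrow> (nat \<Rightarrow> 'a) \<Rightarrow> ('a \<rightharpoonup> 'a)" where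
  "range_proj_join \<Lambda> n \<alpha> = Some |` (\<Union>i\<in>{1..n}. rideal \<Lambda> (\<alpha> i))"

section \<open>The two spaces\<close>

text \<open>The topology on a family \<open>\<A>\<close> of subsets of \<open>P\<close> with basis the sets
  \<open>{S \<in> \<A>. X \<subseteq> S, Y \<inter> S = \<emptyset>}\<close>, \<open>X\<close> and \<open>Y\<close> finite. These are closed under finite intersections
  and include \<open>\<A>\<close>, so they are a basis of the topology they generate.\<close>

definition cylinder_topology :: "'b set \<Rightarrow> 'b set set \<Rightarrow> 'b set topology" where
  "cylinder_topology P \<A> = topology_generated_by
     {{S \<in> \<A>. X \<subseteq> S \<and> Y \<inter> S = {}} | X Y. finite X \<and> X \<subseteq> P \<and> finite Y \<and> Y \<subseteq> P}"

lemma topspace_cylinder_topology: "topspace (cylinder_topology P \<A>) = \<A>"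
proof -
  have "\<A> = {S \<in> \<A>. {} \<subseteq> S \<and> {} \<inter> S = {}}" by simp
  then have "\<A> \<in> {{S \<in> \<A>. X \<subseteq> S \<and> Y \<inter> S = {}} | X Y. finite X \<and> X \<subseteq> P \<and> finite Y \<and> Y \<subseteq> P}"
    by blast
  then show ?thesis
    unfolding cylinder_topology_def topology_generated_by_topspace by blast
qed

definition filters :: "('a, 'm) small_cat_scheme \<Rightarrow> ('a \<rightharpoonup> 'a) set set" where
  "filters \<Lambda> = {\<eta>. \<eta> \<subseteq> idems \<Lambda> \<and> \<eta> \<noteq> {} \<and> Map.empty \<notin> \<eta> \<and>
     (\<forall>e\<in>\<eta>. \<forall>f\<in>idems \<Lambda>. idem_le e f \<longrightarrow> f \<in> \<eta>) \<and>
     (\<forall>e\<in>\<eta>. \<forall>f\<in>\<eta>. e \<circ>\<^sub>m f \<in> \<eta>)}"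

definition filter_space :: "('a, 'm) small_cat_scheme \<Rightarrow> ('a \<rightharpoonup> 'a) set topology" where
  "filter_space \<Lambda> = cylinder_topology (idems \<Lambda>) (filters \<Lambda>)"

definition cond_star :: "('a, 'm) small_cat_scheme \<Rightarrow> ('a \<rightharpoonup> 'a) set \<Rightarrow> bool" where
  "cond_star \<Lambda> \<eta> \<longleftrightarrow>
     (\<forall>n \<alpha>. (\<forall>i\<in>{1..n}. \<alpha> i \<in> mor \<Lambda>) \<longrightarrow> range_proj_join \<Lambda> n \<alpha> \<in> \<eta> \<longrightarrow>
        (\<exists>j\<in>{1..n}. range_proj \<Lambda> (\<alpha> j) \<in> \<eta>))"

definition star_filters :: "('a, 'm) small_cat_scheme \<Rightarrow> ('a \<rightharpoonup> 'a) set set" where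
  "star_filters \<Lambda> = {\<eta> \<in> filters \<Lambda>. cond_star \<Lambda> \<eta>}"

definition star_filter_space :: "('a, 'm) small_cat_scheme \<Rightarrow> ('a \<rightharpoonup> 'a) set topology" where
  "star_filter_space \<Lambda> = subtopology (filter_space \<Lambda>) (star_filters \<Lambda>)"

lemma topspace_star_filter_space: "topspace (star_filter_space \<Lambda>) = star_filters \<Lambda>"
  by (auto simp: star_filter_space_def filter_space_def topspace_cylinder_topology star_filters_def)

text \<open>The set written \<open>\<Lambda>\<^sup>*\<close>.\<close>

definition hereditary_directed :: "('a, 'm) small_cat_scheme \<Rightarrow> 'a set set" where
  "hereditary_directed \<Lambda> = {F. F \<subseteq> mor \<Lambda> \<and> F \<noteq> {} \<and>
     (\<forall>\<alpha>\<in>mor \<Lambda>. \<forall>\<beta>\<in>F. cat_le \<Lambda> \<alpha> \<beta> \<longrightarrow> \<alpha> \<in> F) \<and>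
     (\<forall>\<alpha>\<in>F. \<forall>\<beta>\<in>F. \<exists>\<gamma>\<in>F. cat_le \<Lambda> \<alpha> \<gamma> \<and> cat_le \<Lambda> \<beta> \<gamma>)}"

definition hereditary_directed_space :: "('a, 'm) small_cat_scheme \<Rightarrow> 'a set topology" where
  "hereditary_directed_space \<Lambda> = cylinder_topology (mor \<Lambda>) (hereditary_directed \<Lambda>)"

lemma topspace_hereditary_directed_space:
  "topspace (hereditary_directed_space \<Lambda>) = hereditary_directed \<Lambda>"
  by (simp add: hereditary_directed_space_def topspace_cylinder_topology)

definition Delta :: "('a, 'm) small_cat_scheme \<Rightarrow> ('a \<rightharpoonup> 'a) set \<Rightarrow> 'a set" where
  "Delta \<Lambda> \<eta> = {\<alpha> \<in> mor \<Lambda>. range_proj \<Lambda> \<alpha> \<in> \<eta>}"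

definition eta :: "('a, 'm) small_cat_scheme \<Rightarrow> 'a set \<Rightarrow> ('a \<rightharpoonup> 'a) set" where
  "eta \<Lambda> F = {f \<in> idems \<Lambda>. \<exists>\<alpha>\<in>F. idem_le (range_proj \<Lambda> \<alpha>) f}"

end

theory Submission
  imports Defs
begin

text \<open>By finite alignment every element of the inverse semigroup is a finite union of maps
  \<open>\<tau>\<^sup>\<alpha>\<sigma>\<^sup>\<beta>\<close>, so an idempotent is the identity map of a finite union \<open>\<Union>\<^sub>i \<alpha>\<^sub>i\<Lambda>\<close>.
  For a filter \<open>\<eta>\<close> with \<open>(*)\<close>, or for \<open>\<eta> = \<eta>\<^sub>F\<close>, such an idempotent lies in \<open>\<eta>\<close> exactly when some
  \<open>\<alpha>\<^sub>i\<close> lies in \<open>\<Delta>\<^sub>\<eta>\<close>, respectively in \<open>F\<close>. So each of the two maps pulls the condition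
  \<open>p \<in> S\<close> back to a finite disjunction of conditions of the same kind, which is clopen.\<close>

section \<open>Cylinder topologies\<close>

lemma openin_cylinder_topology_mem:
  assumes "p \<in> P"
  shows "openin (cylinder_topology P \<A>) {S \<in> \<A>. p \<in> S}"
proof -
  have "{S \<in> \<A>. p \<in> S} = {S \<in> \<A>. {p} \<subseteq> S \<and> {} \<inter> S = {}}"
    by simp
  then have "{S \<in> \<A>. p \<in> S} \<in>
      {{S \<in> \<A>. X \<subseteq> S \<and> Y \<inter> S = {}} | X Y. finite X \<and> X \<subseteq> P \<and> finite Y \<and> Y \<subseteq> P}"
    using assms by blast
  then show ?thesis
    unfolding cylinder_topology_def by (rule topology_generated_by_Basis)
qed

lemma openin_cylinder_topology_not_mem:
  assumes "p \<in> P"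
  shows "openin (cylinder_topology P \<A>) {S \<in> \<A>. p \<notin> S}"
proof -
  have "{S \<in> \<A>. p \<notin> S} = {S \<in> \<A>. {} \<subseteq> S \<and> {p} \<inter> S = {}}"
    by simp
  then have "{S \<in> \<A>. p \<notin> S} \<in>
      {{S \<in> \<A>. X \<subseteq> S \<and> Y \<inter> S = {}} | X Y. finite X \<and> X \<subseteq> P \<and> finite Y \<and> Y \<subseteq> P}"
    using assms by blast
  then show ?thesis
    unfolding cylinder_topology_def by (rule topology_generated_by_Basis)
qed

text \<open>A basic set imposes finitely many conditions \<open>p \<in> S\<close> or
  \<open>p \<notin> S\<close>, so its preimage is a finite intersection of preimages for single
  points. Continuity thus reduces to the two families of conditions on one \<open>p\<close>.\<close>

lemma continuous_map_cylinder_topology: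
  assumes maps: "f \<in> topspace T \<rightarrow> \<A>"
    and mem: "\<And>p. p \<in> P \<Longrightarrow> openin T {x \<in> topspace T. p \<in> f x}"
    and not_mem: "\<And>p. p \<in> P \<Longrightarrow> openin T {x \<in> topspace T. p \<notin> f x}"
  shows "continuous_map T (cylinder_topology P \<A>) f"
  unfolding cylinder_topology_def
proof (rule continuous_on_generated_topo)
  fix U
  assume "U \<in> {{S \<in> \<A>. X \<subseteq> S \<and> Y \<inter> S = {}} | X Y. finite X \<and> X \<subseteq> P \<and> finite Y \<and> Y \<subseteq> P}"
  then obtain X Y where U: "U = {S \<in> \<A>. X \<subseteq> S \<and> Y \<inter> S = {}}"
    and fin: "finite X" "finite Y" and sub: "X \<subseteq> P" "Y \<subseteq> P"
    by blast
  \<comment> \<open>If \<open>X\<close> and \<open>Y\<close> are both empty, the intersection over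
    \<open>?C\<close> is the whole type; intersecting with \<open>topspace T\<close> covers this
    case too.\<close>
  let ?C = "(\<lambda>p. {x \<in> topspace T. p \<in> f x}) ` X \<union> (\<lambda>p. {x \<in> topspace T. p \<notin> f x}) ` Y"
  have "f -` U \<inter> topspace T = topspace T \<inter> \<Inter>?C"
    unfolding U using maps by auto
  moreover have "openin T (topspace T \<inter> \<Inter>?C)"
    using fin sub mem not_mem by (intro openin_Int_Inter) auto
  ultimately show "openin T (f -` U \<inter> topspace T)"
    by simp
next
  have "\<Union>{{S \<in> \<A>. X \<subseteq> S \<and> Y \<inter> S = {}} | X Y. finite X \<and> X \<subseteq> P \<and> finite Y \<and> Y \<subseteq> P} = \<A>"
    using topspace_cylinder_topology[of P \<A>]
    unfolding cylinder_topology_def topology_generated_by_topspace .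
  then show "f ` topspace T \<subseteq>
      \<Union>{{S \<in> \<A>. X \<subseteq> S \<and> Y \<inter> S = {}} | X Y. finite X \<and> X \<subseteq> P \<and> finite Y \<and> Y \<subseteq> P}"
    using maps by auto
qed

section \<open>Identity maps of subsets\<close>

lemma restrict_Some_comp: "(Some |` A) \<circ>\<^sub>m (Some |` B) = Some |` (A \<inter> B)"
  by (auto simp: map_comp_def restrict_map_def fun_eq_iff)

lemma restrict_Some_inject:
  fixes A B :: "'a set"
  shows "Some |` A = Some |` B \<longleftrightarrow> A = B"
proof
  have dom: "dom (Some |` C) = C" for C :: "'a set"
    by (auto simp: restrict_map_def split: if_splits)
  assume "Some |` A = Some |` B"
  then show "A = B"
    using dom by metis
qed simp

text \<open>Identity maps multiply by intersecting their domains, so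
  \<open>e = e \<circ>\<^sub>m f\<close> becomes \<open>A = A \<inter> B\<close>.\<close>

lemma idem_le_restrict_Some: "idem_le (Some |` A) (Some |` B) \<longleftrightarrow> A \<subseteq> B"
  by (auto simp: idem_le_def restrict_Some_comp restrict_Some_inject)

text \<open>Injectivity makes the description \<open>THE\<close> in \<open>pinverse\<close> denote
  the only preimage; afterwards \<open>pinverse\<close> is used solely through this
  equivalence.\<close>

lemma pinverse_eq_Some_iff:
  assumes "\<And>x x' y. f x = Some y \<Longrightarrow> f x' = Some y \<Longrightarrow> x = x'"
  shows "pinverse f y = Some x \<longleftrightarrow> f x = Some y"
proof -
  have "(THE x. f x = Some y) = x" if "f x = Some y" for x
    using that assms by blast
  then show ?thesis
    by (auto simp: pinverse_def)
qed

section \<open>Finitely aligned left cancellative small categories\<close>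

locale finitely_aligned_lcsc = small_category +
  assumes cancel: "left_cancellative \<Lambda>"
    and aligned: "finitely_aligned \<Lambda>"
begin

section \<open>Principal right ideals and the order on morphisms\<close>

lemma cmp_left_cancel:
  assumes "\<alpha> \<in> mor \<Lambda>" "\<beta> \<in> mor \<Lambda>" "\<gamma> \<in> mor \<Lambda>" "rng \<Lambda> \<beta> = src \<Lambda> \<alpha>" "rng \<Lambda> \<gamma> = src \<Lambda> \<alpha>"
  shows "\<alpha> \<cdot> \<beta> = \<alpha> \<cdot> \<gamma> \<longleftrightarrow> \<beta> = \<gamma>"
  using assms cancel unfolding left_cancellative_def by metis

lemma rideal_self: "\<alpha> \<in> mor \<Lambda> \<Longrightarrow> \<alpha> \<in> rideal \<Lambda> \<alpha>"
  using cmp_src[of \<alpha>] rng_src[of \<alpha>] src_mor[of \<alpha>] by (force simp: rideal_def)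

text \<open>An ideal contains its generator, which gives one direction. Conversely, if \<beta> =
  \<alpha>\<delta>, associativity turns each \<beta>\<epsilon> into
  \<alpha>(\<delta>\<epsilon>).\<close>

lemma rideal_subset_iff:
  assumes "\<alpha> \<in> mor \<Lambda>" "\<beta> \<in> mor \<Lambda>"
  shows "rideal \<Lambda> \<beta> \<subseteq> rideal \<Lambda> \<alpha> \<longleftrightarrow> cat_le \<Lambda> \<alpha> \<beta>"
proof
  assume "rideal \<Lambda> \<beta> \<subseteq> rideal \<Lambda> \<alpha>"
  then show "cat_le \<Lambda> \<alpha> \<beta>"
    using rideal_self[OF assms(2)] by (auto simp: cat_le_def)
next
  assume "cat_le \<Lambda> \<alpha> \<beta>"
  then obtain \<delta> where \<delta>: "\<delta> \<in> mor \<Lambda>" "rng \<Lambda> \<delta> = src \<Lambda> \<alpha>" "\<beta> = \<alpha> \<cdot> \<delta>"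
    by (auto simp: cat_le_def rideal_def)
  show "rideal \<Lambda> \<beta> \<subseteq> rideal \<Lambda> \<alpha>"
  proof
    fix x
    assume "x \<in> rideal \<Lambda> \<beta>"
    then obtain \<epsilon> where \<epsilon>: "\<epsilon> \<in> mor \<Lambda>" "rng \<Lambda> \<epsilon> = src \<Lambda> \<beta>" "x = \<beta> \<cdot> \<epsilon>"
      by (auto simp: rideal_def)
    have "src \<Lambda> \<delta> = rng \<Lambda> \<epsilon>"
      using \<delta> \<epsilon> assms(1) src_cmp by simp
    then have "x = \<alpha> \<cdot> (\<delta> \<cdot> \<epsilon>)" "\<delta> \<cdot> \<epsilon> \<in> mor \<Lambda>" "rng \<Lambda> (\<delta> \<cdot> \<epsilon>) = src \<Lambda> \<alpha>"
      using \<delta> \<epsilon> assms(1) cmp_assoc cmp_mor rng_cmp by auto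
    then show "x \<in> rideal \<Lambda> \<alpha>"
      by (auto simp: rideal_def)
  qed
qed

text \<open>The object s(\<alpha>) acts as a left identity on the morphisms with range s(\<alpha>),
  so its ideal is exactly the set of morphisms that compose with \<alpha> on the right.\<close>

lemma rideal_src: "\<alpha> \<in> mor \<Lambda> \<Longrightarrow> rideal \<Lambda> (src \<Lambda> \<alpha>) = {\<beta> \<in> mor \<Lambda>. rng \<Lambda> \<beta> = src \<Lambda> \<alpha>}"
  using rng_cmp_id src_src by (force simp: rideal_def)

section \<open>The generators and the range projections\<close>

lemma tau_eq_Some_iff:
  assumes "\<alpha> \<in> mor \<Lambda>"
  shows "tau \<Lambda> \<alpha> x = Some y \<longleftrightarrow> x \<in> mor \<Lambda> \<and> rng \<Lambda> x = src \<Lambda> \<alpha> \<and> y = \<alpha> \<cdot> x"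
  using rideal_src[OF assms] by (auto simp: tau_def)

text \<open>Left cancellation makes \<open>tau \<Lambda> \<alpha>\<close> injective, so
  \<open>pinverse\<close> yields its genuine inverse.\<close>

lemma sigma_eq_Some_iff:
  assumes "\<alpha> \<in> mor \<Lambda>"
  shows "sigma \<Lambda> \<alpha> y = Some x \<longleftrightarrow> x \<in> mor \<Lambda> \<and> rng \<Lambda> x = src \<Lambda> \<alpha> \<and> y = \<alpha> \<cdot> x"
  unfolding sigma_def
  by (subst pinverse_eq_Some_iff) (auto simp: tau_eq_Some_iff assms cmp_left_cancel)

text \<open>\<open>sigma\<close> removes the prefix \<alpha> and \<open>tau\<close> restores it, so
  the composite fixes every element of \<alpha>\<Lambda> and is undefined elsewhere.\<close>

lemma range_proj_eq:
  assumes "\<alpha> \<in> mor \<Lambda>"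
  shows "range_proj \<Lambda> \<alpha> = Some |` rideal \<Lambda> \<alpha>"
proof -
  have "range_proj \<Lambda> \<alpha> x = Some y \<longleftrightarrow> (Some |` rideal \<Lambda> \<alpha>) x = Some y" for x y
    using assms
    by (auto simp: range_proj_def map_comp_Some_iff tau_eq_Some_iff sigma_eq_Some_iff
        restrict_map_def rideal_def)
  then show ?thesis
    by (metis ext option.exhaust)
qed

lemma range_proj_idems:
  assumes "\<alpha> \<in> mor \<Lambda>"
  shows "range_proj \<Lambda> \<alpha> \<in> idems \<Lambda>"
proof -
  have "range_proj \<Lambda> \<alpha> \<in> inv_semigroup \<Lambda>"
    unfolding range_proj_def
    using assms by (intro inv_semigroup.product inv_semigroup.tau inv_semigroup.sigma)
  then show ?thesis
    by (simp add: idems_def range_proj_eq[OF assms] restrict_Some_comp)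
qed

section \<open>Semigroup elements as finite unions of bisections\<close>

text \<open>The graph of \<open>\<tau>\<^sup>\<alpha>\<sigma>\<^sup>\<beta>\<close>.\<close>

definition bisection :: "'a \<times> 'a \<Rightarrow> ('a \<times> 'a) set" where
  "bisection p = {(snd p \<cdot> \<delta>, fst p \<cdot> \<delta>) | \<delta>. \<delta> \<in> mor \<Lambda> \<and> rng \<Lambda> \<delta> = src \<Lambda> (snd p)}"

text \<open>Equality of the sources guarantees that both products in \<open>bisection\<close> are
  composable for the same \<delta>, so that \<open>bisection\<close> really is the graph of
  \<open>\<tau>\<^sup>\<alpha>\<sigma>\<^sup>\<beta>\<close>.\<close>

definition parallel_pairs :: "('a \<times> 'a) set" where
  "parallel_pairs = {(\<alpha>, \<beta>). \<alpha> \<in> mor \<Lambda> \<and> \<beta> \<in> mor \<Lambda> \<and> src \<Lambda> \<alpha> = src \<Lambda> \<beta>}"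

text \<open>For p = (\<alpha>, \<beta>) and q = (\<gamma>, \<delta>), the intermediate points of the
  composite lie in \<beta>\<Lambda> \<inter> \<gamma>\<Lambda>, a finite union of ideals
  \<epsilon>\<Lambda> by alignment. Writing \<epsilon> = \<beta>\<mu> = \<gamma>\<nu>, the part
  passing through \<epsilon>\<Lambda> sends \<delta>\<nu>\<kappa> to \<alpha>\<mu>\<kappa>, so it is
  the bisection of the pair (\<alpha>\<mu>, \<delta>\<nu>).\<close>

lemma bisection_relcomp:
  assumes p: "p \<in> parallel_pairs" and q: "q \<in> parallel_pairs"
  shows "\<exists>R. finite R \<and> R \<subseteq> parallel_pairs \<and>
           bisection q O bisection p = (\<Union>r\<in>R. bisection r)"
proof -
  obtain \<alpha> \<beta> where p_eq: "p = (\<alpha>, \<beta>)" and ab: "\<alpha> \<in> mor \<Lambda>" "\<beta> \<in> mor \<Lambda>" "src \<Lambda> \<alpha> = src \<Lambda> \<beta>"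
    using p by (auto simp: parallel_pairs_def)
  obtain \<gamma> \<delta> where q_eq: "q = (\<gamma>, \<delta>)" and cd: "\<gamma> \<in> mor \<Lambda>" "\<delta> \<in> mor \<Lambda>" "src \<Lambda> \<gamma> = src \<Lambda> \<delta>"
    using q by (auto simp: parallel_pairs_def)
  obtain \<Gamma> where \<Gamma>: "finite \<Gamma>" "\<Gamma> \<subseteq> mor \<Lambda>" "rideal \<Lambda> \<beta> \<inter> rideal \<Lambda> \<gamma> = (\<Union>\<epsilon>\<in>\<Gamma>. rideal \<Lambda> \<epsilon>)"
    using aligned ab cd unfolding finitely_aligned_def by metis
  have "\<exists>\<mu> \<nu>. \<mu> \<in> mor \<Lambda> \<and> \<nu> \<in> mor \<Lambda> \<and> rng \<Lambda> \<mu> = src \<Lambda> \<beta> \<and> rng \<Lambda> \<nu> = src \<Lambda> \<gamma> \<and>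
      \<epsilon> = \<beta> \<cdot> \<mu> \<and> \<epsilon> = \<gamma> \<cdot> \<nu>" if "\<epsilon> \<in> \<Gamma>" for \<epsilon>
  proof -
    have "\<epsilon> \<in> rideal \<Lambda> \<beta> \<inter> rideal \<Lambda> \<gamma>"
      using that \<Gamma> rideal_self by blast
    then show ?thesis
      by (fastforce simp: rideal_def)
  qed
  then obtain M N where
    M: "\<And>\<epsilon>. \<epsilon> \<in> \<Gamma> \<Longrightarrow> M \<epsilon> \<in> mor \<Lambda> \<and> rng \<Lambda> (M \<epsilon>) = src \<Lambda> \<beta> \<and> \<epsilon> = \<beta> \<cdot> M \<epsilon>" and
    N: "\<And>\<epsilon>. \<epsilon> \<in> \<Gamma> \<Longrightarrow> N \<epsilon> \<in> mor \<Lambda> \<and> rng \<Lambda> (N \<epsilon>) = src \<Lambda> \<gamma> \<and> \<epsilon> = \<gamma> \<cdot> N \<epsilon>"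
    by metis
  \<comment> \<open>Both cofactors inherit the source of \<epsilon>; this makes the new pair
    parallel and lets one \<kappa> extend both sides.\<close>
  have srcM: "src \<Lambda> (M \<epsilon>) = src \<Lambda> \<epsilon>" and srcN: "src \<Lambda> (N \<epsilon>) = src \<Lambda> \<epsilon>" if "\<epsilon> \<in> \<Gamma>" for \<epsilon>
    using M[OF that] N[OF that] ab cd src_cmp by metis+
  let ?r = "\<lambda>\<epsilon>. (\<alpha> \<cdot> M \<epsilon>, \<delta> \<cdot> N \<epsilon>)"
  have par: "?r \<epsilon> \<in> parallel_pairs" if "\<epsilon> \<in> \<Gamma>" for \<epsilon>
    using M[OF that] N[OF that] srcM[OF that] srcN[OF that] ab cd
    by (auto simp: parallel_pairs_def cmp_mor src_cmp)
  have ext: "\<beta> \<cdot> (M \<epsilon> \<cdot> \<kappa>) = \<epsilon> \<cdot> \<kappa>" "\<gamma> \<cdot> (N \<epsilon> \<cdot> \<kappa>) = \<epsilon> \<cdot> \<kappa>"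
    "\<alpha> \<cdot> M \<epsilon> \<cdot> \<kappa> = \<alpha> \<cdot> (M \<epsilon> \<cdot> \<kappa>)" "\<delta> \<cdot> N \<epsilon> \<cdot> \<kappa> = \<delta> \<cdot> (N \<epsilon> \<cdot> \<kappa>)"
    "M \<epsilon> \<cdot> \<kappa> \<in> mor \<Lambda>" "rng \<Lambda> (M \<epsilon> \<cdot> \<kappa>) = src \<Lambda> \<beta>"
    "N \<epsilon> \<cdot> \<kappa> \<in> mor \<Lambda>" "rng \<Lambda> (N \<epsilon> \<cdot> \<kappa>) = src \<Lambda> \<gamma>"
    "src \<Lambda> (\<delta> \<cdot> N \<epsilon>) = src \<Lambda> \<epsilon>"
    if "\<epsilon> \<in> \<Gamma>" "\<kappa> \<in> mor \<Lambda>" "rng \<Lambda> \<kappa> = src \<Lambda> \<epsilon>" for \<epsilon> \<kappa>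
  proof -
    have m: "M \<epsilon> \<in> mor \<Lambda>" "rng \<Lambda> (M \<epsilon>) = src \<Lambda> \<beta>" "\<beta> \<cdot> M \<epsilon> = \<epsilon>" "src \<Lambda> (M \<epsilon>) = rng \<Lambda> \<kappa>"
      and n: "N \<epsilon> \<in> mor \<Lambda>" "rng \<Lambda> (N \<epsilon>) = src \<Lambda> \<gamma>" "\<gamma> \<cdot> N \<epsilon> = \<epsilon>" "src \<Lambda> (N \<epsilon>) = rng \<Lambda> \<kappa>"
      using M[OF that(1)] N[OF that(1)] srcM[OF that(1)] srcN[OF that(1)] that(3) by auto
    show "\<beta> \<cdot> (M \<epsilon> \<cdot> \<kappa>) = \<epsilon> \<cdot> \<kappa>" "\<alpha> \<cdot> M \<epsilon> \<cdot> \<kappa> = \<alpha> \<cdot> (M \<epsilon> \<cdot> \<kappa>)"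
      "M \<epsilon> \<cdot> \<kappa> \<in> mor \<Lambda>" "rng \<Lambda> (M \<epsilon> \<cdot> \<kappa>) = src \<Lambda> \<beta>"
      using m ab that(2) cmp_assoc cmp_mor rng_cmp by metis+
    show "\<gamma> \<cdot> (N \<epsilon> \<cdot> \<kappa>) = \<epsilon> \<cdot> \<kappa>" "\<delta> \<cdot> N \<epsilon> \<cdot> \<kappa> = \<delta> \<cdot> (N \<epsilon> \<cdot> \<kappa>)"
      "N \<epsilon> \<cdot> \<kappa> \<in> mor \<Lambda>" "rng \<Lambda> (N \<epsilon> \<cdot> \<kappa>) = src \<Lambda> \<gamma>"
      using n cd that(2) cmp_assoc cmp_mor rng_cmp by metis+
    show "src \<Lambda> (\<delta> \<cdot> N \<epsilon>) = src \<Lambda> \<epsilon>"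
      using n cd src_cmp that(3) by metis
  qed
  have "bisection q O bisection p = (\<Union>\<epsilon>\<in>\<Gamma>. bisection (?r \<epsilon>))"
  proof (intro equalityI subsetI)
    fix z
    assume "z \<in> bisection q O bisection p"
    then obtain \<mu> \<nu> where mu: "\<mu> \<in> mor \<Lambda>" "rng \<Lambda> \<mu> = src \<Lambda> \<delta>"
      and nu: "\<nu> \<in> mor \<Lambda>" "rng \<Lambda> \<nu> = src \<Lambda> \<beta>"
      and z: "z = (\<delta> \<cdot> \<mu>, \<alpha> \<cdot> \<nu>)" and meet: "\<gamma> \<cdot> \<mu> = \<beta> \<cdot> \<nu>"
      by (auto simp: bisection_def p_eq q_eq)
    have "\<gamma> \<cdot> \<mu> \<in> rideal \<Lambda> \<gamma>"
      using mu cd(3) by (auto simp: rideal_def)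
    moreover have "\<gamma> \<cdot> \<mu> \<in> rideal \<Lambda> \<beta>"
      using nu meet by (auto simp: rideal_def)
    ultimately obtain \<epsilon> where "\<epsilon> \<in> \<Gamma>" "\<gamma> \<cdot> \<mu> \<in> rideal \<Lambda> \<epsilon>"
      using \<Gamma>(3) by blast
    then obtain \<kappa> where e: "\<epsilon> \<in> \<Gamma>" "\<kappa> \<in> mor \<Lambda>" "rng \<Lambda> \<kappa> = src \<Lambda> \<epsilon>" "\<gamma> \<cdot> \<mu> = \<epsilon> \<cdot> \<kappa>"
      by (auto simp: rideal_def)
    note x = ext[OF e(1-3)]
    \<comment> \<open>Left cancellation enters here: \<gamma> is cancelled from two factorizations
      of \<epsilon>\<kappa>, and then \<beta> in the same way for \<nu>.\<close>
    have "\<mu> = N \<epsilon> \<cdot> \<kappa>"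
      using x e(4) mu cd cmp_left_cancel by metis
    moreover have "\<nu> = M \<epsilon> \<cdot> \<kappa>"
      using x e(4) meet nu ab cmp_left_cancel by metis
    ultimately have "z \<in> bisection (?r \<epsilon>)"
      unfolding bisection_def using e x z by force
    then show "z \<in> (\<Union>\<epsilon>\<in>\<Gamma>. bisection (?r \<epsilon>))"
      using e(1) by blast
  next
    fix z
    assume "z \<in> (\<Union>\<epsilon>\<in>\<Gamma>. bisection (?r \<epsilon>))"
    then obtain \<epsilon> \<kappa> where e: "\<epsilon> \<in> \<Gamma>" "\<kappa> \<in> mor \<Lambda>" "rng \<Lambda> \<kappa> = src \<Lambda> (\<delta> \<cdot> N \<epsilon>)"
      "z = (\<delta> \<cdot> N \<epsilon> \<cdot> \<kappa>, \<alpha> \<cdot> M \<epsilon> \<cdot> \<kappa>)"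
      by (auto simp: bisection_def)
    have "rng \<Lambda> \<kappa> = src \<Lambda> \<epsilon>"
      using e(3) N[OF e(1)] srcN[OF e(1)] cd src_cmp by metis
    note x = ext[OF e(1,2) this]
    have "(\<delta> \<cdot> (N \<epsilon> \<cdot> \<kappa>), \<gamma> \<cdot> (N \<epsilon> \<cdot> \<kappa>)) \<in> bisection q"
      unfolding bisection_def q_eq using x cd by force
    moreover have "(\<beta> \<cdot> (M \<epsilon> \<cdot> \<kappa>), \<alpha> \<cdot> (M \<epsilon> \<cdot> \<kappa>)) \<in> bisection p"
      unfolding bisection_def p_eq using x by force
    ultimately show "z \<in> bisection q O bisection p"
      using x e(4) by auto
  qed
  then show ?thesis
    using \<Gamma>(1) par by (intro exI[of _ "?r ` \<Gamma>"]) auto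
qed

text \<open>Injectivity of the generators comes from left cancellation and survives inverses and
  products. It is what allows \<open>pinverse\<close> to be read as relational converse on the whole
  semigroup.\<close>

lemma inv_semigroup_inj:
  assumes "f \<in> inv_semigroup \<Lambda>" "f x = Some y" "f x' = Some y"
  shows "x = x'"
  using assms
proof (induction arbitrary: x x' y)
  case (tau \<alpha>)
  then show ?case
    by (auto simp: tau_eq_Some_iff cmp_left_cancel)
next
  case (sigma \<alpha>)
  then show ?case
    by (auto simp: sigma_eq_Some_iff)
next
  case (inverse f)
  have "pinverse f a = Some b \<longleftrightarrow> f b = Some a" for a b
    by (rule pinverse_eq_Some_iff) (rule inverse.IH)
  then show ?case
    using inverse.prems by simp
next
  case (product f g)
  then show ?case
  proof -
    obtain a b where "g x = Some a" "f a = Some y" "g x' = Some b" "f b = Some y"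
      using product.prems by (auto simp: map_comp_Some_iff)
    moreover from this have "a = b"
      by (intro product.IH(1))
    ultimately show ?thesis
      using product.IH(2) by simp
  qed
qed

text \<open>Each generator is one bisection, with s(\<alpha>) as the other entry of the pair.
  Inversion swaps the entries of every pair, and composition distributes over the unions, leaving
  products of single bisections for \<open>bisection_relcomp\<close>.\<close>

lemma inv_semigroup_graph:
  assumes "f \<in> inv_semigroup \<Lambda>"
  shows "\<exists>P. finite P \<and> P \<subseteq> parallel_pairs \<and> Map.graph f = (\<Union>p\<in>P. bisection p)"
  using assms
proof induction
  case (tau \<alpha>)
  have "Map.graph (tau \<Lambda> \<alpha>) = bisection (\<alpha>, src \<Lambda> \<alpha>)"
    using tau by (auto simp: Map.graph_def tau_eq_Some_iff bisection_def src_src)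
      (metis rng_cmp_id)+
  then show ?case
    using tau by (intro exI[of _ "{(\<alpha>, src \<Lambda> \<alpha>)}"]) (auto simp: parallel_pairs_def src_mor src_src)
next
  case (sigma \<alpha>)
  have "Map.graph (sigma \<Lambda> \<alpha>) = bisection (src \<Lambda> \<alpha>, \<alpha>)"
    using sigma by (auto simp: Map.graph_def sigma_eq_Some_iff bisection_def)
      (metis rng_cmp_id)+
  then show ?case
    using sigma by (intro exI[of _ "{(src \<Lambda> \<alpha>, \<alpha>)}"]) (auto simp: parallel_pairs_def src_mor src_src)
next
  case (inverse f)
  then obtain P where P: "finite P" "P \<subseteq> parallel_pairs" "Map.graph f = (\<Union>p\<in>P. bisection p)"
    by blast
  have "pinverse f a = Some b \<longleftrightarrow> f b = Some a" for a b
    by (rule pinverse_eq_Some_iff) (rule inv_semigroup_inj[OF inverse.hyps])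
  then have "Map.graph (pinverse f) = (Map.graph f)\<inverse>"
    by (auto simp: Map.graph_def)
  moreover have "(bisection p)\<inverse> = bisection (prod.swap p)" if "p \<in> P" for p
  proof -
    \<comment> \<open>The definition of \<open>bisection\<close> constrains \<delta> by the source
      of the second entry only; parallelism makes this condition symmetric.\<close>
    have "src \<Lambda> (fst p) = src \<Lambda> (snd p)"
      using that P(2) by (auto simp: parallel_pairs_def)
    then show ?thesis
      by (auto simp: bisection_def)
  qed
  ultimately have "Map.graph (pinverse f) = (\<Union>p\<in>prod.swap ` P. bisection p)"
    unfolding P(3) by (auto simp: converse_UNION)
  moreover have "prod.swap ` P \<subseteq> parallel_pairs"
    using P(2) by (auto simp: parallel_pairs_def)
  ultimately show ?case
    using P(1) by blast
next
  case (product f g)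
  obtain P where P: "finite P" "P \<subseteq> parallel_pairs" "Map.graph f = (\<Union>p\<in>P. bisection p)"
    using product.IH(1) by blast
  obtain Q where Q: "finite Q" "Q \<subseteq> parallel_pairs" "Map.graph g = (\<Union>p\<in>Q. bisection p)"
    using product.IH(2) by blast
  obtain R where R: "\<And>p q. p \<in> parallel_pairs \<Longrightarrow> q \<in> parallel_pairs \<Longrightarrow> finite (R p q) \<and>
      R p q \<subseteq> parallel_pairs \<and> bisection q O bisection p = (\<Union>r\<in>R p q. bisection r)"
    using bisection_relcomp by metis
  \<comment> \<open>The order flips because \<open>O\<close> applies its left factor first, whereas
    \<open>\<circ>\<^sub>m\<close> applies the right one first.\<close>
  have "Map.graph (f \<circ>\<^sub>m g) = Map.graph g O Map.graph f"
    by (auto simp: Map.graph_def map_comp_Some_iff)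
  also have "\<dots> = (\<Union>p\<in>P. \<Union>q\<in>Q. bisection q O bisection p)"
    unfolding P(3) Q(3) by blast
  also have "\<dots> = (\<Union>p\<in>P. \<Union>q\<in>Q. \<Union>r\<in>R p q. bisection r)"
    using R P(2) Q(2) by (intro SUP_cong refl) blast
  also have "\<dots> = (\<Union>r\<in>(\<Union>p\<in>P. \<Union>q\<in>Q. R p q). bisection r)"
    by blast
  finally have "Map.graph (f \<circ>\<^sub>m g) = (\<Union>r\<in>(\<Union>p\<in>P. \<Union>q\<in>Q. R p q). bisection r)" .
  moreover have "finite (\<Union>p\<in>P. \<Union>q\<in>Q. R p q)"
    using P(1,2) Q(1,2) R by blast
  moreover have "(\<Union>p\<in>P. \<Union>q\<in>Q. R p q) \<subseteq> parallel_pairs"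
    using P(2) Q(2) R by blast
  ultimately show ?case
    by blast
qed

section \<open>Idempotents as identity maps of finite unions of ideals\<close>

text \<open>An injective idempotent partial map fixes its domain pointwise, and the domain of a
  bisection of (\<alpha>, \<beta>) is \<beta>\<Lambda>. The second entries of the pairs in the graph
  therefore serve as \<open>A\<close>.\<close>

lemma idems_eq_restrict_Some:
  assumes "e \<in> idems \<Lambda>"
  obtains A where "finite A" "A \<subseteq> mor \<Lambda>" "e = Some |` (\<Union>\<alpha>\<in>A. rideal \<Lambda> \<alpha>)"
proof -
  have e: "e \<in> inv_semigroup \<Lambda>" and idem: "e \<circ>\<^sub>m e = e"
    using assms by (auto simp: idems_def)
  obtain P where P: "finite P" "P \<subseteq> parallel_pairs" "Map.graph e = (\<Union>p\<in>P. bisection p)"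
    using inv_semigroup_graph[OF e] by blast
  have ident: "y = x" if "e x = Some y" for x y
  proof -
    \<comment> \<open>Idempotency at \<open>x\<close> shows that \<open>x\<close> and
      \<open>y\<close> have the same image \<open>y\<close>; injectivity then identifies
      them.\<close>
    have "e y = Some y"
      using that fun_cong[OF idem, of x] by (simp add: map_comp_def)
    then show ?thesis
      using inv_semigroup_inj[OF e] that by blast
  qed
  have "x \<in> dom e \<longleftrightarrow> x \<in> (\<Union>\<alpha>\<in>snd ` P. rideal \<Lambda> \<alpha>)" for x
  proof -
    have "x \<in> dom e \<longleftrightarrow> (\<exists>y. (x, y) \<in> Map.graph e)"
      by (auto simp: Map.graph_def)
    also have "\<dots> \<longleftrightarrow> x \<in> (\<Union>\<alpha>\<in>snd ` P. rideal \<Lambda> \<alpha>)"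
      unfolding P(3) by (auto simp: bisection_def rideal_def)
    finally show ?thesis .
  qed
  then have "dom e = (\<Union>\<alpha>\<in>snd ` P. rideal \<Lambda> \<alpha>)"
    by blast
  moreover have "e = Some |` dom e"
    using ident by (fastforce simp: restrict_map_def fun_eq_iff)
  moreover have "finite (snd ` P)" "snd ` P \<subseteq> mor \<Lambda>"
    using P(1,2) by (auto simp: parallel_pairs_def)
  ultimately show thesis
    using that[of "snd ` P"] by simp
qed

lemma idems_comp:
  assumes "e \<in> idems \<Lambda>" "f \<in> idems \<Lambda>"
  shows "e \<circ>\<^sub>m f \<in> idems \<Lambda>"
proof -
  obtain A B where "e = Some |` A" "f = Some |` B"
    using assms idems_eq_restrict_Some by metis
  then show ?thesis
    using assms inv_semigroup.product[of e \<Lambda> f] by (simp add: idems_def restrict_Some_comp)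
qed

section \<open>From filters to hereditary directed sets\<close>

lemma cond_star_finite:
  assumes "cond_star \<Lambda> \<eta>" "finite A" "A \<subseteq> mor \<Lambda>" "Some |` (\<Union>\<alpha>\<in>A. rideal \<Lambda> \<alpha>) \<in> \<eta>"
  shows "\<exists>\<alpha>\<in>A. range_proj \<Lambda> \<alpha> \<in> \<eta>"
proof -
  obtain h where "bij_betw h {1..card A} A"
    using ex_bij_betw_nat_finite_1[OF assms(2)] by blast
  then have img: "h ` {1..card A} = A"
    by (rule bij_betw_imp_surj_on)
  have "range_proj_join \<Lambda> (card A) h = Some |` (\<Union>\<alpha>\<in>h ` {1..card A}. rideal \<Lambda> \<alpha>)"
    unfolding range_proj_join_def by simp
  then have "range_proj_join \<Lambda> (card A) h \<in> \<eta>"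
    using assms(4) unfolding img by simp
  then have "\<exists>j\<in>{1..card A}. range_proj \<Lambda> (h j) \<in> \<eta>"
    using assms(1,3) img unfolding cond_star_def by blast
  then show ?thesis
    using img by blast
qed

lemma range_proj_le_iff:
  assumes "\<alpha> \<in> mor \<Lambda>" "\<beta> \<in> mor \<Lambda>"
  shows "idem_le (range_proj \<Lambda> \<beta>) (range_proj \<Lambda> \<alpha>) \<longleftrightarrow> cat_le \<Lambda> \<alpha> \<beta>"
  using assms by (simp add: range_proj_eq idem_le_restrict_Some rideal_subset_iff)

lemma Delta_hereditary_directed:
  assumes "\<eta> \<in> star_filters \<Lambda>"
  shows "Delta \<Lambda> \<eta> \<in> hereditary_directed \<Lambda>"
proof -
  have sub: "\<eta> \<subseteq> idems \<Lambda>" and ne: "\<eta> \<noteq> {}" and star: "cond_star \<Lambda> \<eta>"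
    and up: "\<And>e f. e \<in> \<eta> \<Longrightarrow> f \<in> idems \<Lambda> \<Longrightarrow> idem_le e f \<Longrightarrow> f \<in> \<eta>"
    and prod: "\<And>e f. e \<in> \<eta> \<Longrightarrow> f \<in> \<eta> \<Longrightarrow> e \<circ>\<^sub>m f \<in> \<eta>"
    using assms by (auto simp: star_filters_def filters_def)
  obtain e where e: "e \<in> \<eta>"
    using ne by blast
  then obtain A where "finite A" "A \<subseteq> mor \<Lambda>" "e = Some |` (\<Union>\<alpha>\<in>A. rideal \<Lambda> \<alpha>)"
    using sub idems_eq_restrict_Some by blast
  then have "Delta \<Lambda> \<eta> \<noteq> {}"
    using e cond_star_finite[OF star] by (fastforce simp: Delta_def)
  moreover have "\<alpha> \<in> Delta \<Lambda> \<eta>"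
    if "\<alpha> \<in> mor \<Lambda>" "\<beta> \<in> Delta \<Lambda> \<eta>" "cat_le \<Lambda> \<alpha> \<beta>" for \<alpha> \<beta>
    using that up range_proj_idems range_proj_le_iff unfolding Delta_def by blast
  moreover have "\<exists>\<gamma>\<in>Delta \<Lambda> \<eta>. cat_le \<Lambda> \<alpha> \<gamma> \<and> cat_le \<Lambda> \<beta> \<gamma>"
    if "\<alpha> \<in> Delta \<Lambda> \<eta>" "\<beta> \<in> Delta \<Lambda> \<eta>" for \<alpha> \<beta>
  proof -
    have ab: "\<alpha> \<in> mor \<Lambda>" "\<beta> \<in> mor \<Lambda>"
      using that by (auto simp: Delta_def)
    obtain \<Gamma> where \<Gamma>: "finite \<Gamma>" "\<Gamma> \<subseteq> mor \<Lambda>" "rideal \<Lambda> \<alpha> \<inter> rideal \<Lambda> \<beta> = (\<Union>\<gamma>\<in>\<Gamma>. rideal \<Lambda> \<gamma>)"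
      using aligned ab unfolding finitely_aligned_def by metis
    have "range_proj \<Lambda> \<alpha> \<circ>\<^sub>m range_proj \<Lambda> \<beta> \<in> \<eta>"
      using that prod by (auto simp: Delta_def)
    then have "Some |` (\<Union>\<gamma>\<in>\<Gamma>. rideal \<Lambda> \<gamma>) \<in> \<eta>"
      using ab \<Gamma>(3) by (simp add: range_proj_eq restrict_Some_comp)
    then obtain \<gamma> where "\<gamma> \<in> \<Gamma>" "range_proj \<Lambda> \<gamma> \<in> \<eta>"
      using cond_star_finite[OF star \<Gamma>(1,2)] by blast
    moreover from this have "\<gamma> \<in> rideal \<Lambda> \<alpha> \<inter> rideal \<Lambda> \<beta>"
      using \<Gamma>(2,3) rideal_self by blast
    ultimately show ?thesis
      using \<Gamma>(2) by (auto simp: Delta_def cat_le_def)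
  qed
  moreover have "Delta \<Lambda> \<eta> \<subseteq> mor \<Lambda>"
    by (auto simp: Delta_def)
  ultimately show ?thesis
    by (auto simp: hereditary_directed_def)
qed

section \<open>From hereditary directed sets to filters\<close>

text \<open>If \<beta>\<Lambda> lies in the union, then so does its generator \<beta>, which hence
  belongs to a single \<alpha>\<Lambda>. Thus \<alpha> \<le> \<beta> \<in> F, and heredity puts
  \<alpha> in F.\<close>

lemma restrict_Some_in_eta_iff:
  assumes F: "F \<in> hereditary_directed \<Lambda>" and A: "A \<subseteq> mor \<Lambda>"
    and e: "Some |` (\<Union>\<alpha>\<in>A. rideal \<Lambda> \<alpha>) \<in> idems \<Lambda>"
  shows "Some |` (\<Union>\<alpha>\<in>A. rideal \<Lambda> \<alpha>) \<in> eta \<Lambda> F \<longleftrightarrow> A \<inter> F \<noteq> {}"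
proof
  assume "Some |` (\<Union>\<alpha>\<in>A. rideal \<Lambda> \<alpha>) \<in> eta \<Lambda> F"
  then obtain \<beta> where \<beta>: "\<beta> \<in> F" "idem_le (range_proj \<Lambda> \<beta>) (Some |` (\<Union>\<alpha>\<in>A. rideal \<Lambda> \<alpha>))"
    by (auto simp: eta_def)
  have "\<beta> \<in> mor \<Lambda>"
    using \<beta>(1) F by (auto simp: hereditary_directed_def)
  then have "\<beta> \<in> (\<Union>\<alpha>\<in>A. rideal \<Lambda> \<alpha>)"
    using \<beta>(2) rideal_self by (auto simp: range_proj_eq idem_le_restrict_Some)
  then obtain \<alpha> where "\<alpha> \<in> A" "cat_le \<Lambda> \<alpha> \<beta>"
    by (auto simp: cat_le_def)
  then show "A \<inter> F \<noteq> {}"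
    using \<beta>(1) F A unfolding hereditary_directed_def by blast
next
  assume "A \<inter> F \<noteq> {}"
  then obtain \<alpha> where "\<alpha> \<in> A" "\<alpha> \<in> F"
    by blast
  moreover from this have "idem_le (range_proj \<Lambda> \<alpha>) (Some |` (\<Union>\<alpha>\<in>A. rideal \<Lambda> \<alpha>))"
    using A by (subst range_proj_eq) (auto simp: idem_le_restrict_Some)
  ultimately show "Some |` (\<Union>\<alpha>\<in>A. rideal \<Lambda> \<alpha>) \<in> eta \<Lambda> F"
    using e by (auto simp: eta_def)
qed

lemma range_proj_in_eta_iff:
  assumes "F \<in> hereditary_directed \<Lambda>" "\<alpha> \<in> mor \<Lambda>"
  shows "range_proj \<Lambda> \<alpha> \<in> eta \<Lambda> F \<longleftrightarrow> \<alpha> \<in> F"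
  using restrict_Some_in_eta_iff[OF assms(1), of "{\<alpha>}"] assms(2) range_proj_idems[OF assms(2)]
  by (simp add: range_proj_eq)

lemma eta_star_filters:
  assumes F: "F \<in> hereditary_directed \<Lambda>"
  shows "eta \<Lambda> F \<in> star_filters \<Lambda>"
proof -
  have Fm: "F \<subseteq> mor \<Lambda>" and ne: "F \<noteq> {}"
    and dir: "\<And>\<alpha> \<beta>. \<alpha> \<in> F \<Longrightarrow> \<beta> \<in> F \<Longrightarrow> \<exists>\<gamma>\<in>F. cat_le \<Lambda> \<alpha> \<gamma> \<and> cat_le \<Lambda> \<beta> \<gamma>"
    using F by (auto simp: hereditary_directed_def)
  have mem: "Some |` B \<in> eta \<Lambda> F \<longleftrightarrow> Some |` B \<in> idems \<Lambda> \<and> (\<exists>\<alpha>\<in>F. rideal \<Lambda> \<alpha> \<subseteq> B)" for B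
    using Fm by (auto simp: eta_def range_proj_eq idem_le_restrict_Some subset_iff)
  have sub: "eta \<Lambda> F \<subseteq> idems \<Lambda>"
    by (auto simp: eta_def)
  have "eta \<Lambda> F \<noteq> {}"
    using ne Fm range_proj_in_eta_iff[OF F] by blast
  moreover have "Map.empty \<notin> eta \<Lambda> F"
  proof
    assume "Map.empty \<in> eta \<Lambda> F"
    then have "Some |` {} \<in> eta \<Lambda> F"
      by simp
    then obtain \<alpha> where "\<alpha> \<in> F" "rideal \<Lambda> \<alpha> \<subseteq> {}"
      using mem by blast
    then show False
      using Fm rideal_self by blast
  qed
  moreover have "f \<in> eta \<Lambda> F" if e: "e \<in> eta \<Lambda> F" and f: "f \<in> idems \<Lambda>" and le: "idem_le e f" for e f
  proof -
    obtain A B where AB: "e = Some |` A" "f = Some |` B"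
      using e f sub idems_eq_restrict_Some by (metis subsetD)
    then have "A \<subseteq> B"
      using le by (simp add: idem_le_restrict_Some)
    then show ?thesis
      using e f mem unfolding AB by blast
  qed
  moreover have "e \<circ>\<^sub>m f \<in> eta \<Lambda> F" if e: "e \<in> eta \<Lambda> F" and f: "f \<in> eta \<Lambda> F" for e f
  proof -
    obtain A B where AB: "e = Some |` A" "f = Some |` B"
      using e f sub idems_eq_restrict_Some by (metis subsetD)
    obtain \<alpha> \<beta> where ab: "\<alpha> \<in> F" "\<beta> \<in> F" "rideal \<Lambda> \<alpha> \<subseteq> A" "rideal \<Lambda> \<beta> \<subseteq> B"
      using e f mem unfolding AB by blast
    then obtain \<gamma> where "\<gamma> \<in> F" "cat_le \<Lambda> \<alpha> \<gamma>" "cat_le \<Lambda> \<beta> \<gamma>"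
      using dir by blast
    then have "\<gamma> \<in> F" "rideal \<Lambda> \<gamma> \<subseteq> A \<inter> B"
      using ab Fm rideal_subset_iff by blast+
    moreover have "Some |` (A \<inter> B) \<in> idems \<Lambda>"
      using e f sub idems_comp unfolding AB restrict_Some_comp[symmetric] by blast
    ultimately show ?thesis
      unfolding AB restrict_Some_comp using mem by blast
  qed
  moreover have "cond_star \<Lambda> (eta \<Lambda> F)"
    unfolding cond_star_def
  proof (intro allI impI)
    fix n :: nat and \<alpha> :: "nat \<Rightarrow> 'a"
    assume m: "\<forall>i\<in>{1..n}. \<alpha> i \<in> mor \<Lambda>" and j: "range_proj_join \<Lambda> n \<alpha> \<in> eta \<Lambda> F"
    have "range_proj_join \<Lambda> n \<alpha> = Some |` (\<Union>\<beta>\<in>\<alpha> ` {1..n}. rideal \<Lambda> \<beta>)"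
      by (simp add: range_proj_join_def)
    then have "\<alpha> ` {1..n} \<inter> F \<noteq> {}"
      using restrict_Some_in_eta_iff[OF F, of "\<alpha> ` {1..n}"] j m sub by auto
    then show "\<exists>j\<in>{1..n}. range_proj \<Lambda> (\<alpha> j) \<in> eta \<Lambda> F"
      using m range_proj_in_eta_iff[OF F] by blast
  qed
  ultimately show ?thesis
    using sub by (simp add: star_filters_def filters_def)
qed

section \<open>The two maps are mutually inverse\<close>

lemma Delta_eta:
  assumes "F \<in> hereditary_directed \<Lambda>"
  shows "Delta \<Lambda> (eta \<Lambda> F) = F"
proof -
  have "F \<subseteq> mor \<Lambda>"
    using assms by (auto simp: hereditary_directed_def)
  then show ?thesis
    using range_proj_in_eta_iff[OF assms] by (auto simp: Delta_def)
qed

lemma eta_Delta: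
  assumes "\<eta> \<in> star_filters \<Lambda>"
  shows "eta \<Lambda> (Delta \<Lambda> \<eta>) = \<eta>"
proof
  have sub: "\<eta> \<subseteq> idems \<Lambda>" and star: "cond_star \<Lambda> \<eta>"
    and up: "\<And>e f. e \<in> \<eta> \<Longrightarrow> f \<in> idems \<Lambda> \<Longrightarrow> idem_le e f \<Longrightarrow> f \<in> \<eta>"
    using assms by (auto simp: star_filters_def filters_def)
  show "eta \<Lambda> (Delta \<Lambda> \<eta>) \<subseteq> \<eta>"
    using up unfolding eta_def Delta_def by blast
  show "\<eta> \<subseteq> eta \<Lambda> (Delta \<Lambda> \<eta>)"
  proof
    fix e
    assume e: "e \<in> \<eta>"
    then obtain A where A: "finite A" "A \<subseteq> mor \<Lambda>" "e = Some |` (\<Union>\<alpha>\<in>A. rideal \<Lambda> \<alpha>)"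
      using sub idems_eq_restrict_Some by blast
    then have "A \<inter> Delta \<Lambda> \<eta> \<noteq> {}"
      using e cond_star_finite[OF star] by (fastforce simp: Delta_def)
    then show "e \<in> eta \<Lambda> (Delta \<Lambda> \<eta>)"
      using restrict_Some_in_eta_iff[OF Delta_hereditary_directed[OF assms] A(2)] A(3) e sub
      by blast
  qed
qed

section \<open>Continuity of both maps\<close>

text \<open>The condition \<alpha> \<in> \<open>Delta \<Lambda> \<eta>\<close> is membership of one
  idempotent in \<eta>, so both preimages are traces of cylinder sets of the filter space.\<close>

lemma continuous_map_Delta:
  "continuous_map (star_filter_space \<Lambda>) (hereditary_directed_space \<Lambda>) (Delta \<Lambda>)"
  unfolding hereditary_directed_space_def
proof (rule continuous_map_cylinder_topology)
  show "Delta \<Lambda> \<in> topspace (star_filter_space \<Lambda>) \<rightarrow> hereditary_directed \<Lambda>"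
    using Delta_hereditary_directed by (simp add: topspace_star_filter_space)
next
  fix \<alpha>
  assume \<alpha>: "\<alpha> \<in> mor \<Lambda>"
  have "{\<eta> \<in> star_filters \<Lambda>. \<alpha> \<in> Delta \<Lambda> \<eta>}
      = {\<eta> \<in> filters \<Lambda>. range_proj \<Lambda> \<alpha> \<in> \<eta>} \<inter> star_filters \<Lambda>"
    "{\<eta> \<in> star_filters \<Lambda>. \<alpha> \<notin> Delta \<Lambda> \<eta>}
      = {\<eta> \<in> filters \<Lambda>. range_proj \<Lambda> \<alpha> \<notin> \<eta>} \<inter> star_filters \<Lambda>"
    using \<alpha> by (auto simp: Delta_def star_filters_def)
  moreover have "openin (star_filter_space \<Lambda>) ({\<eta> \<in> filters \<Lambda>. range_proj \<Lambda> \<alpha> \<in> \<eta>} \<inter> star_filters \<Lambda>)"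
    "openin (star_filter_space \<Lambda>) ({\<eta> \<in> filters \<Lambda>. range_proj \<Lambda> \<alpha> \<notin> \<eta>} \<inter> star_filters \<Lambda>)"
    unfolding star_filter_space_def filter_space_def
    using range_proj_idems[OF \<alpha>]
    by (auto intro!: openin_subtopology_Int openin_cylinder_topology_mem
        openin_cylinder_topology_not_mem)
  ultimately show "openin (star_filter_space \<Lambda>) {\<eta> \<in> topspace (star_filter_space \<Lambda>). \<alpha> \<in> Delta \<Lambda> \<eta>}"
    "openin (star_filter_space \<Lambda>) {\<eta> \<in> topspace (star_filter_space \<Lambda>). \<alpha> \<notin> Delta \<Lambda> \<eta>}"
    by (simp_all add: topspace_star_filter_space)
qed

lemma continuous_map_eta:
  "continuous_map (hereditary_directed_space \<Lambda>) (star_filter_space \<Lambda>) (eta \<Lambda>)"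
proof -
  let ?T = "hereditary_directed_space \<Lambda>"
  have "continuous_map ?T (filter_space \<Lambda>) (eta \<Lambda>)"
    unfolding filter_space_def
  proof (rule continuous_map_cylinder_topology)
    show "eta \<Lambda> \<in> topspace ?T \<rightarrow> filters \<Lambda>"
      using eta_star_filters by (auto simp: topspace_hereditary_directed_space star_filters_def)
  next
    fix e
    assume e: "e \<in> idems \<Lambda>"
    then obtain A where A: "finite A" "A \<subseteq> mor \<Lambda>" "e = Some |` (\<Union>\<alpha>\<in>A. rideal \<Lambda> \<alpha>)"
      using idems_eq_restrict_Some by blast
    have iff: "e \<in> eta \<Lambda> F \<longleftrightarrow> A \<inter> F \<noteq> {}" if "F \<in> hereditary_directed \<Lambda>" for F
      using restrict_Some_in_eta_iff[OF that A(2)] A(3) e by simp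
    have "{F \<in> topspace ?T. e \<in> eta \<Lambda> F} = (\<Union>\<alpha>\<in>A. {F \<in> hereditary_directed \<Lambda>. \<alpha> \<in> F})"
      using iff by (auto simp: topspace_hereditary_directed_space)
    also have "openin ?T \<dots>"
      unfolding hereditary_directed_space_def
      using A(2) by (intro openin_Union) (auto intro!: openin_cylinder_topology_mem)
    finally show "openin ?T {F \<in> topspace ?T. e \<in> eta \<Lambda> F}" .
    \<comment> \<open>Non-membership is an intersection over \<open>A\<close>, open because
      \<open>A\<close> is finite; the factor \<open>topspace ?T\<close> takes care of empty
      \<open>A\<close>.\<close>
    have "{F \<in> topspace ?T. e \<notin> eta \<Lambda> F}
        = topspace ?T \<inter> \<Inter>((\<lambda>\<alpha>. {F \<in> hereditary_directed \<Lambda>. \<alpha> \<notin> F}) ` A)"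
      using iff by (auto simp: topspace_hereditary_directed_space)
    also have "openin ?T \<dots>"
      unfolding hereditary_directed_space_def
      using A(1,2) by (intro openin_Int_Inter) (auto intro!: openin_cylinder_topology_not_mem)
    finally show "openin ?T {F \<in> topspace ?T. e \<notin> eta \<Lambda> F}" .
  qed
  then show ?thesis
    unfolding star_filter_space_def
    using eta_star_filters
    by (auto simp: continuous_map_in_subtopology topspace_hereditary_directed_space)
qed

end

theorem lemma3p23:
  fixes \<Lambda> :: "('a, 'm) small_cat_scheme"
  assumes "small_category \<Lambda>"
    and "left_cancellative \<Lambda>"
    and "finitely_aligned \<Lambda>"
  shows "homeomorphic_maps (star_filter_space \<Lambda>) (hereditary_directed_space \<Lambda>)
           (Delta \<Lambda>) (eta \<Lambda>)"
proof -
  interpret finitely_aligned_lcsc \<Lambda>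
    using assms by (simp add: finitely_aligned_lcsc_def finitely_aligned_lcsc_axioms_def)
  show ?thesis
    unfolding homeomorphic_maps_def
    using continuous_map_Delta continuous_map_eta eta_Delta Delta_eta
    by (simp add: topspace_star_filter_space topspace_hereditary_directed_space)
qed

end
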